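(* Let $\mathcal{I}=\{1,\dots,I\}$ and let $f_i$, $i\in\mathcal{I}$, be probability density functions on $\mathbb{R}^d$. Let $\mathbb{W}=\{\mathbf{w}\in\mathbb{R}^I : \sum_{i\in\mathcal{I}}w_i=1,\ w_i\ge 0\ \forall i\in\mathcal{I}\}$ and, for $\mathbf{w}\in\mathbb{W}$, let $f_{\mathrm{AA}}(\mathbf{w})=\sum_{i\in\mathcal{I}}w_if_i$. If $\mathbf{w}^*\in\mathbb{W}$ satisfies $$D_{\mathrm{KL}}\big(f_i\,\|\,f_{\mathrm{AA}}(\mathbf{w}^* )\big)=D_{\mathrm{KL}}\big(f_j\,\|\,f_{\mathrm{AA}}(\mathbf{w}^* )\big)\qquad\text{for all } i,j\in\mathcal{I},$$ then $\mathbf{w}^*$ is a solution of the maximization problem $$\mathop{\arg\max}_{\mathbf{w}\in\mathbb{W}}\ \sum_{i\in\mathcal{I}}w_i\,D_{\mathrm{KL}}\big(f_i\,\|\,f_{\mathrm{AA}}(\mathbf{w})\big).$$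
   Context: $D_{\mathrm{KL}}(f\|p)=\int_{\mathbb{R}^d}f(\mathbf{x})\log\frac{f(\mathbf{x})}{p(\mathbf{x})}\,d\mathbf{x}$ is the Kullback–Leibler divergence. In the objective, terms with $w_i=0$ are taken to be zero. *)

theory Defs
  imports "HOL-Analysis.Analysis"
begin

definition is_pdf :: "(real ^ 'd \<Rightarrow> real) \<Rightarrow> bool" where
  "is_pdf f \<longleftrightarrow> f \<in> borel_measurable lborel \<and> (\<forall>x. 0 \<le> f x) \<and>
     (\<integral>\<^sup>+ x. ennreal (f x) \<partial>lborel) = 1"

(* Integrand of the divergence, with the usual conventions 0 log (0/b) = 0 and
   a log (a/0) = \<infinity> for a > 0.  The second one must be spelled out, since
   a / 0 = 0 and ln 0 = 0 on type real. *)
definition kl_integrand :: "real \<Rightarrow> real \<Rightarrow> ereal" where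
  "kl_integrand a b =
     (if a = 0 then 0 else if b = 0 then \<infinity> else ereal (a * ln (a / b)))"

(* The divergence is extended-real valued: it may be \<infinity>, and the real-valued
   constant KL_divergence of HOL-Probability would return an arbitrary real in that case.
   The integral is that of the positive part minus that of the negative part (e2ennreal
   sends negative numbers to 0).  As a ln (a/b) \<ge> a - b, the second integral is at most 1
   for densities, so \<infinity> - \<infinity> does not occur. *)
definition D_KL :: "(real ^ 'd \<Rightarrow> real) \<Rightarrow> (real ^ 'd \<Rightarrow> real) \<Rightarrow> ereal" where
  "D_KL f p =
     enn2ereal (\<integral>\<^sup>+ x. e2ennreal (kl_integrand (f x) (p x)) \<partial>lborel) -
     enn2ereal (\<integral>\<^sup>+ x. e2ennreal (- kl_integrand (f x) (p x)) \<partial>lborel)"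

definition weights :: "(real ^ 'i) set" where
  "weights = {w. (\<Sum>i\<in>UNIV. w $ i) = 1 \<and> (\<forall>i. 0 \<le> w $ i)}"

definition f_AA :: "('i::finite \<Rightarrow> real ^ 'd \<Rightarrow> real) \<Rightarrow> real ^ 'i \<Rightarrow> real ^ 'd \<Rightarrow> real" where
  "f_AA f w = (\<lambda>x. \<Sum>i\<in>UNIV. w $ i * f i x)"

definition objective :: "('i::finite \<Rightarrow> real ^ 'd \<Rightarrow> real) \<Rightarrow> real ^ 'i \<Rightarrow> ereal" where
  "objective f w =
     (\<Sum>i\<in>UNIV. if w $ i = 0 then 0 else ereal (w $ i) * D_KL (f i) (f_AA f w))"

end

theory Submission
  imports Defs
begin

text \<open>For \<^term>\<open>w \<in> weights\<close> the compensation identity reads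
  \<open>(\<Sum>i. w\<^sub>i D(f\<^sub>i \<parallel> p)) = (\<Sum>i. w\<^sub>i D(f\<^sub>i \<parallel> f\<^sub>w)) + D(f\<^sub>w \<parallel> p)\<close>, where \<open>f\<^sub>w\<close> is the mixture.
  With \<open>p\<close> the mixture of \<open>w_star\<close>, the left-hand side is the common divergence, that is, the
  objective at \<open>w_star\<close>; the first summand on the right is the objective at \<open>w\<close>, and the last one
  is nonnegative. All divergences involved are finite because \<open>w\<^sub>i f\<^sub>i \<le> f\<^sub>w\<close>.\<close>

lemma is_pdfD:
  assumes "is_pdf f"
  shows "f \<in> borel_measurable lborel" "0 \<le> f x" "(\<integral>\<^sup>+ x. ennreal (f x) \<partial>lborel) = 1"
  using assms by (auto simp: is_pdf_def)

lemma is_pdf_integrable: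
  assumes "is_pdf f"
  shows "integrable lborel f" "(\<integral>x. f x \<partial>lborel) = 1"
proof -
  show "integrable lborel f"
    using is_pdfD[OF assms] by (intro integrableI_nonneg) auto
  show "(\<integral>x. f x \<partial>lborel) = 1"
    using is_pdfD[OF assms] by (subst integral_eq_nn_integral) auto
qed

lemma is_pdf_f_AA:
  assumes "\<And>i. is_pdf (f i)" and "w \<in> weights"
  shows "is_pdf (f_AA f w)"
proof -
  note f = is_pdfD[OF assms(1)]
  have w: "0 \<le> w $ i" for i
    using assms(2) by (simp add: weights_def)
  have "(\<integral>\<^sup>+ x. ennreal (f_AA f w x) \<partial>lborel)
      = (\<integral>\<^sup>+ x. (\<Sum>i\<in>UNIV. ennreal (w $ i) * ennreal (f i x)) \<partial>lborel)"
    using f(2) w by (simp add: f_AA_def ennreal_mult flip: sum_ennreal)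
  also have "\<dots> = (\<Sum>i\<in>UNIV. ennreal (w $ i))"
    using f by (simp add: nn_integral_sum nn_integral_cmult)
  also have "\<dots> = 1"
    using assms(2) by (simp add: weights_def)
  finally show ?thesis
    using f w by (auto simp: is_pdf_def f_AA_def intro!: sum_nonneg)
qed

text \<open>This is \<open>ln t \<le> t - 1\<close> at \<open>t = b / a\<close>, scaled by
  \<open>a\<close>. It serves twice: to bound the negative part of the divergence integrand, and to
  give the last divergence of the compensation identity its sign.\<close>

lemma mult_ln_div_ge:
  fixes a b :: real
  assumes "0 < a" "0 < b"
  shows "a - b \<le> a * ln (a / b)"
proof -
  have "a * ln (b / a) \<le> a * (b / a - 1)"
    using assms by (intro mult_left_mono ln_le_minus_one) auto
  also have "a * (b / a - 1) = b - a"
    using assms by (simp add: field_simps)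
  finally show ?thesis
    using assms by (simp add: ln_div right_diff_distrib)
qed

lemma e2ennreal_ereal_eq [simp]: "e2ennreal (ereal r) = ennreal r"
  by (simp add: ennreal_def)

lemma e2ennreal_0 [simp]: "e2ennreal 0 = 0"
  by (simp add: e2ennreal_neg)

lemma measurable_kl_integrand [measurable]:
  assumes [measurable]: "f \<in> borel_measurable M" "p \<in> borel_measurable M"
  shows "(\<lambda>x. kl_integrand (f x) (p x)) \<in> borel_measurable M"
  unfolding kl_integrand_def by measurable

text \<open>Pointwise \<open>- (a * ln (a / b)) \<le> b - a \<le> b\<close>, so the negative part is
  dominated by the density \<open>p\<close>. Where the integrand is \<infinity>, its negative part
  is 0.\<close>

lemma nn_integral_kl_neg_finite:
  assumes "is_pdf f" "is_pdf p"
  shows "(\<integral>\<^sup>+ x. e2ennreal (- kl_integrand (f x) (p x)) \<partial>lborel) < \<infinity>"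
proof -
  have "e2ennreal (- kl_integrand (f x) (p x)) \<le> ennreal (p x)" for x
    using mult_ln_div_ge[of "f x" "p x"] is_pdfD(2)[OF assms(1), of x] is_pdfD(2)[OF assms(2), of x]
    by (auto simp: kl_integrand_def e2ennreal_neg intro!: ennreal_leI)
  then have "(\<integral>\<^sup>+ x. e2ennreal (- kl_integrand (f x) (p x)) \<partial>lborel)
      \<le> (\<integral>\<^sup>+ x. ennreal (p x) \<partial>lborel)"
    by (intro nn_integral_mono)
  then show ?thesis
    using is_pdfD(3)[OF assms(2)] by (auto simp: less_top[symmetric] top_unique)
qed

lemma D_KL_neq_PInf_iff:
  assumes "is_pdf f" "is_pdf p"
  shows "D_KL f p \<noteq> \<infinity> \<longleftrightarrow> (\<integral>\<^sup>+ x. e2ennreal (kl_integrand (f x) (p x)) \<partial>lborel) < \<infinity>"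
  using nn_integral_kl_neg_finite[OF assms] unfolding D_KL_def
  by (cases "\<integral>\<^sup>+ x. e2ennreal (kl_integrand (f x) (p x)) \<partial>lborel";
      cases "\<integral>\<^sup>+ x. e2ennreal (- kl_integrand (f x) (p x)) \<partial>lborel") auto

text \<open>A finite positive part confines the value \<infinity> to a null set. Off that set the
  extended integrand is the real function \<open>f x * ln (f x / p x)\<close>, so later arguments
  can use real-valued integrals.\<close>

lemma D_KL_finite:
  assumes "is_pdf f" "is_pdf p" "D_KL f p \<noteq> \<infinity>"
  shows "AE x in lborel. f x = 0 \<or> p x \<noteq> 0"
    and "integrable lborel (\<lambda>x. f x * ln (f x / p x))"
    and "D_KL f p = ereal (\<integral>x. f x * ln (f x / p x) \<partial>lborel)"
proof -
  let ?g = "\<lambda>x. f x * ln (f x / p x)"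
  note [measurable] = is_pdfD(1)[OF assms(1)] is_pdfD(1)[OF assms(2)]
  have pos: "(\<integral>\<^sup>+ x. e2ennreal (kl_integrand (f x) (p x)) \<partial>lborel) < \<infinity>"
    using D_KL_neq_PInf_iff assms by blast
  then have "AE x in lborel. e2ennreal (kl_integrand (f x) (p x)) \<noteq> \<infinity>"
    by (intro nn_integral_PInf_AE) auto
  then show ae: "AE x in lborel. f x = 0 \<or> p x \<noteq> 0"
    by eventually_elim (auto simp: kl_integrand_def split: if_splits)
  have p: "(\<integral>\<^sup>+ x. e2ennreal (kl_integrand (f x) (p x)) \<partial>lborel) = (\<integral>\<^sup>+ x. ennreal (?g x) \<partial>lborel)"
    using ae by (intro nn_integral_cong_AE, eventually_elim) (auto simp: kl_integrand_def)
  have n: "(\<integral>\<^sup>+ x. e2ennreal (- kl_integrand (f x) (p x)) \<partial>lborel) = (\<integral>\<^sup>+ x. ennreal (- ?g x) \<partial>lborel)"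
    using ae by (intro nn_integral_cong_AE, eventually_elim) (auto simp: kl_integrand_def)
  show int: "integrable lborel ?g"
    using pos nn_integral_kl_neg_finite[OF assms(1,2)] by (simp add: real_integrable_def p n less_top)
  show "D_KL f p = ereal (\<integral>x. ?g x \<partial>lborel)"
    using pos nn_integral_kl_neg_finite[OF assms(1,2)]
    unfolding D_KL_def p n real_lebesgue_integral_def[OF int]
    by (cases "\<integral>\<^sup>+ x. ennreal (?g x) \<partial>lborel"; cases "\<integral>\<^sup>+ x. ennreal (- ?g x) \<partial>lborel") auto
qed

text \<open>Where \<open>f i x > 0\<close>, the logarithm of \<open>f i x / f_AA f w x\<close> is at
  most \<open>- ln (w $ i)\<close>. Hence the positive part is dominated by a constant multiple of
  the density \<open>f i\<close>.\<close>

lemma D_KL_f_AA_finite: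
  fixes f :: "'i::finite \<Rightarrow> real ^ 'd \<Rightarrow> real"
  assumes pdf: "\<And>i. is_pdf (f i)" and w: "w \<in> weights" and i: "w $ i \<noteq> 0"
  shows "D_KL (f i) (f_AA f w) \<noteq> \<infinity>"
proof -
  note [measurable] = is_pdfD(1)[OF pdf]
  have w0: "0 \<le> w $ j" for j
    using w by (simp add: weights_def)
  with i have wi: "0 < w $ i"
    by (simp add: less_le)
  \<comment> \<open>With \<open>w $ i \<le> 1\<close> the constant \<open>- ln (w $ i)\<close> is
    nonnegative, so \<open>ennreal\<close> does not truncate it.\<close>
  have "w $ i \<le> (\<Sum>j\<in>UNIV. w $ j)"
    using w0 by (intro member_le_sum) auto
  then have wi1: "w $ i \<le> 1"
    using w by (simp add: weights_def)
  have bound: "e2ennreal (kl_integrand (f i x) (f_AA f w x)) \<le> ennreal (- ln (w $ i)) * ennreal (f i x)" for x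
  proof (cases "f i x = 0")
    case False
    then have fi: "0 < f i x"
      using is_pdfD(2)[OF pdf, of i x] by simp
    have le: "w $ i * f i x \<le> f_AA f w x"
      unfolding f_AA_def using w0 is_pdfD(2)[OF pdf]
      by (intro member_le_sum[where f = "\<lambda>j. w $ j * f j x"]) auto
    then have pos: "0 < f_AA f w x"
      using mult_pos_pos[OF wi fi] by linarith
    have "ln (w $ i * f i x) \<le> ln (f_AA f w x)"
      using le wi fi by (intro ln_mono) auto
    then have "f i x * ln (f i x / f_AA f w x) \<le> f i x * - ln (w $ i)"
      using fi pos wi by (intro mult_left_mono) (auto simp: ln_div ln_mult)
    then show ?thesis
      using fi pos wi wi1
      by (auto simp: kl_integrand_def mult.commute simp flip: ennreal_mult intro!: ennreal_leI)
  qed (simp add: kl_integrand_def)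
  have "(\<integral>\<^sup>+ x. e2ennreal (kl_integrand (f i x) (f_AA f w x)) \<partial>lborel)
      \<le> (\<integral>\<^sup>+ x. ennreal (- ln (w $ i)) * ennreal (f i x) \<partial>lborel)"
    by (intro nn_integral_mono bound)
  also have "\<dots> < \<infinity>"
    using is_pdfD(3)[OF pdf] by (simp add: nn_integral_cmult)
  finally show ?thesis
    using D_KL_neq_PInf_iff[OF pdf is_pdf_f_AA[where f = f, OF pdf w]] by blast
qed

text \<open>If \<open>w $ i = 0\<close>, the divergence may be infinite and the real integral a mere
  default value, but the term is 0 on both sides. All other terms are finite.\<close>

lemma objective_eq_integral:
  fixes f :: "'i::finite \<Rightarrow> real ^ 'd \<Rightarrow> real"
  assumes pdf: "\<And>i. is_pdf (f i)" and w: "w \<in> weights"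
  shows "objective f w = ereal (\<Sum>i\<in>UNIV. w $ i * (\<integral>x. f i x * ln (f i x / f_AA f w x) \<partial>lborel))"
proof -
  have "D_KL (f i) (f_AA f w) = ereal (\<integral>x. f i x * ln (f i x / f_AA f w x) \<partial>lborel)"
    if "w $ i \<noteq> 0" for i
    by (rule D_KL_finite(3)[OF pdf is_pdf_f_AA[OF pdf w] D_KL_f_AA_finite[where f = f, OF pdf w that]])
  then show ?thesis
    unfolding objective_def by (subst sum_ereal[symmetric], intro sum.cong) auto
qed

text \<open>This is the compensation identity before integration: the right-hand side equals the
  integrand of the divergence of the mixture from \<open>p\<close>. The lower bound is chosen
  because it integrates to 1 - 1 = 0 for densities, so that divergence itself need not be
  integrated.\<close>

lemma compensation_pointwise:
  fixes w :: "real ^ 'i::finite"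
  assumes w: "w \<in> weights" and f: "\<And>i. 0 \<le> f i x" and p: "0 \<le> p x"
    and ac: "\<And>i. f i x = 0 \<or> p x \<noteq> 0"
  shows "f_AA f w x - p x
    \<le> (\<Sum>i\<in>UNIV. w $ i * (f i x * ln (f i x / p x)) - w $ i * (f i x * ln (f i x / f_AA f w x)))"
proof -
  have w0: "0 \<le> w $ i" for i
    using w by (simp add: weights_def)
  have nn: "0 \<le> f_AA f w x"
    using w0 f by (simp add: f_AA_def sum_nonneg)
  show ?thesis
  proof (cases "f_AA f w x = 0")
    \<comment> \<open>Where the mixture vanishes, every summand is 0 and the claim is
      \<open>- p x \<le> 0\<close>.\<close>
    case True
    then have "w $ i * f i x = 0" for i
      using w0 f by (simp add: f_AA_def sum_nonneg_eq_0_iff)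
    then have "w $ i = 0 \<or> f i x = 0" for i
      by simp
    then have "(\<Sum>i\<in>UNIV. w $ i * (f i x * ln (f i x / p x))
        - w $ i * (f i x * ln (f i x / f_AA f w x))) = 0"
      by (intro sum.neutral) auto
    then show ?thesis
      using True p by simp
  next
    case False
    then have "\<exists>i. f i x \<noteq> 0"
      by (auto simp: f_AA_def intro: ccontr)
    then obtain i where "f i x \<noteq> 0" ..
    then have p0: "0 < p x"
      using ac p by (metis less_le)
    have fw0: "0 < f_AA f w x"
      using False nn by simp
    \<comment> \<open>The contributions of \<open>ln (f i x)\<close> cancel. The remaining logarithm
      is independent of \<open>i\<close>, so summation rebuilds the mixture as its factor.\<close>
    have "w $ i * (f i x * ln (f i x / p x)) - w $ i * (f i x * ln (f i x / f_AA f w x))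
        = w $ i * f i x * ln (f_AA f w x / p x)" for i
    proof (cases "f i x = 0")
      case False
      then have "0 < f i x"
        using f[of i] by simp
      then show ?thesis
        using p0 fw0 by (simp add: ln_div algebra_simps)
    qed simp
    then have "(\<Sum>i\<in>UNIV. w $ i * (f i x * ln (f i x / p x))
        - w $ i * (f i x * ln (f i x / f_AA f w x))) = f_AA f w x * ln (f_AA f w x / p x)"
      by (simp add: f_AA_def sum_distrib_right)
    then show ?thesis
      using mult_ln_div_ge[OF fw0 p0] by simp
  qed
qed

theorem lemma5:
  fixes f :: "'i::finite \<Rightarrow> real ^ 'd \<Rightarrow> real"
    and w_star :: "real ^ 'i"
  assumes "\<And>i. is_pdf (f i)"
    and "w_star \<in> weights"
    and "\<And>i j. D_KL (f i) (f_AA f w_star) = D_KL (f j) (f_AA f w_star)"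
  shows "is_arg_max (objective f) (\<lambda>w. w \<in> weights) w_star"
proof -
  define p where "p = f_AA f w_star"
  let ?g = "\<lambda>i x. f i x * ln (f i x / p x)"
  have pdf_p: "is_pdf p"
    unfolding p_def by (rule is_pdf_f_AA[OF assms(1,2)])
  have sum1: "(\<Sum>i\<in>UNIV. w $ i) = 1" if "w \<in> weights" for w :: "real ^ 'i"
    using that by (simp add: weights_def)
  obtain k where k: "w_star $ k \<noteq> 0"
    using sum1[OF assms(2)] by (metis sum.neutral zero_neq_one)
  \<comment> \<open>Finiteness is known at \<open>k\<close>, where the weight is nonzero; equality
    of the divergences carries it to every \<open>i\<close>, even those with
    \<open>w_star $ i = 0\<close>.\<close>
  have fin: "D_KL (f i) p \<noteq> \<infinity>" for i
    using D_KL_f_AA_finite[OF assms(1,2) k] assms(3)[of i k] by (simp add: p_def)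
  note KL = D_KL_finite[OF assms(1) pdf_p fin]
  define c where "c = (\<integral>x. ?g k x \<partial>lborel)"
  have c: "(\<integral>x. ?g i x \<partial>lborel) = c" for i
    using KL(3)[of i] KL(3)[of k] assms(3)[of i k] by (simp add: c_def p_def)
  have "objective f w \<le> objective f w_star" if w: "w \<in> weights" for w
  proof -
    let ?q = "f_AA f w"
    let ?h = "\<lambda>i x. f i x * ln (f i x / ?q x)"
    have pdf_q: "is_pdf ?q"
      by (rule is_pdf_f_AA[OF assms(1) w])
    \<comment> \<open>The weight stays inside: for \<open>w $ i = 0\<close>, \<open>?h i\<close>
      alone may fail to be integrable.\<close>
    have int_h: "integrable lborel (\<lambda>x. w $ i * ?h i x)" for i
      using D_KL_finite(2)[OF assms(1) pdf_q D_KL_f_AA_finite[where f = f, OF assms(1) w]]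
      by (cases "w $ i = 0") auto
    have int_g: "integrable lborel (\<lambda>x. w $ i * ?g i x)" for i
      using KL(2) by simp
    have "AE x in lborel. \<forall>i\<in>UNIV. f i x = 0 \<or> p x \<noteq> 0"
      using KL(1) by (intro AE_finite_allI) auto
    then have "AE x in lborel. ?q x - p x \<le> (\<Sum>i\<in>UNIV. w $ i * ?g i x - w $ i * ?h i x)"
      by eventually_elim
         (rule compensation_pointwise[OF w], auto simp: is_pdfD(2)[OF assms(1)] is_pdfD(2)[OF pdf_p])
    then have "(\<integral>x. ?q x - p x \<partial>lborel)
        \<le> (\<integral>x. (\<Sum>i\<in>UNIV. w $ i * ?g i x - w $ i * ?h i x) \<partial>lborel)"
      using int_g int_h is_pdf_integrable(1)[OF pdf_q] is_pdf_integrable(1)[OF pdf_p]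
      by (intro integral_mono_AE Bochner_Integration.integrable_sum
            Bochner_Integration.integrable_diff) auto
    also have "\<dots> = (\<Sum>i\<in>UNIV. w $ i * (\<integral>x. ?g i x \<partial>lborel) - w $ i * (\<integral>x. ?h i x \<partial>lborel))"
      using int_g int_h
      by (subst Bochner_Integration.integral_sum)
         (auto simp only: Bochner_Integration.integral_diff integral_mult_right_zero
            intro!: Bochner_Integration.integrable_diff)
    also have "\<dots> = c - (\<Sum>i\<in>UNIV. w $ i * (\<integral>x. ?h i x \<partial>lborel))"
      by (simp add: c sum_subtractf sum1[OF w] flip: sum_distrib_right)
    \<comment> \<open>Both \<open>?q\<close> and \<open>p\<close> have integral 1, so the chain
      starts at 0.\<close>
    finally have "(\<Sum>i\<in>UNIV. w $ i * (\<integral>x. ?h i x \<partial>lborel)) \<le> c"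
      using is_pdf_integrable[OF pdf_q] is_pdf_integrable[OF pdf_p] by simp
    \<comment> \<open>At \<open>w_star\<close> the objective is a weighted mean of divergences that
      all equal \<open>c\<close>.\<close>
    moreover have "objective f w_star = ereal c"
      using objective_eq_integral[OF assms(1,2)]
      by (simp add: c sum1[OF assms(2)] flip: p_def sum_distrib_right)
    ultimately show ?thesis
      by (simp add: objective_eq_integral[OF assms(1) w])
  qed
  then show ?thesis
    using assms(2) by (auto simp: is_arg_max_def not_less)
qed

end
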